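(* Let $\mathscr{H}$ be a reproducing kernel Hilbert space on a non-empty set $\mathscr{X}$, let $\theta\in(0,\frac{\pi}{2})$, and let $S,T,X,Y\in\mathscr{B}(\mathscr{H})$ with $S\in\Pi^{\mathbf{Ber},P}_{\theta}$. Then, for each choice of the sign $\pm$, $$\mathbf{ber}(SXT\pm TYS)\ \le\ 2\sin\theta\,\big\|T^*|X|^2T+T|Y^*|^2T^*\big\|_{ber}^{1/2}\Big(\mathbf{ber}^2(S)-\frac{\csc^2\theta}{2}\big(\mathbf{ber}^2(\Im(S))-\mathbf{ber}^2(\Re(S))\big)\Big)^{1/2}.$$
   Context: $\mathscr{H}$ is a complex separable reproducing kernel Hilbert space of complex-valued functions on a non-empty set $\mathscr{X}$: for every $\lambda\in\mathscr{X}$ evaluation at $\lambda$ is continuous, and $k_\lambda\in\mathscr{H}$ denotes the reproducing kernel, $\phi(\lambda)=\langle\phi,k_\lambda\rangle$ for all $\phi\in\mathscr{H}$. It is implicit that $k_\lambda\neq0$, and $\hat k_\lambda=k_\lambda/\|k_\lambda\|$. $\mathscr{B}(\mathscr{H})$ is the algebra of bounded linear operators on $\mathscr{H}$. For $A\in\mathscr{B}(\mathscr{H})$: $|A|=(A^*A)^{1/2}$, $\Re(A)=\frac12(A+A^* )$, $\Im(A)=\frac1{2i}(A-A^* )$, $\Re^n(A)=(\Re(A))^n$, $\Im^n(A)=(\Im(A))^n$; the Berezin transform is $\widetilde A(\lambda)=\langle A\hat k_\lambda,\hat k_\lambda\rangle$; the Berezin range is $\mathbf{Ber}(A)=\{\widetilde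 A(\lambda):\lambda\in\mathscr{X}\}$; the Berezin number is $\mathbf{ber}(A)=\sup_{\lambda\in\mathscr{X}}|\widetilde A(\lambda)|$, and $\mathbf{ber}^n(A)=(\mathbf{ber}(A))^n$; the Berezin norm is $\|A\|_{ber}=\sup_{\lambda,\mu\in\mathscr{X}}|\langle A\hat k_\lambda,\hat k_\mu\rangle|$. For $\theta\in[0,\frac{\pi}{2})$, $S_\theta=\{z\in\mathbb{C}:|\arg z|\le\theta\}$ is the sector with vertex at the origin (vertex included) and semi-angle $\theta$; $\Pi^{\mathbf{Ber}}_\theta$ is the class of $A\in\mathscr{B}(\mathscr{H})$ with $\mathbf{Ber}(A)\subseteq S_\theta$; and $$\Pi^{\mathbf{Ber},P}_\theta=\{A\in\Pi^{\mathbf{Ber}}_\theta:\ \mathbf{ber}(\Re^n(A))\le\mathbf{ber}^n(\Re(A))\ \text{and}\ \mathbf{ber}(\Im^n(A))\le\mathbf{ber}^n(\Im(A))\ \text{for all } n\in\mathbb{N}\}.$$ A known fact: $\|A\|_{ber}=\mathbf{ber}(A)$ for positive operators $A$. *)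

theory Defs
  imports "HOL-Analysis.Analysis"
begin

section \<open>Complex Hilbert spaces\<close>

text \<open>
  The inner product is linear in the first argument. The axiom \<open>cinner_self\<close> says at once that
  \<open>cinner x x\<close> is real and nonnegative, that the inner product is definite, and that the norm (and
  with it the topology and completeness) is the one induced by the inner product.
\<close>

class complex_hilbert = banach +
  fixes scaleC :: "complex \<Rightarrow> 'a \<Rightarrow> 'a"  (infixr \<open>*\<^sub>C\<close> 75)
    and cinner :: "'a \<Rightarrow> 'a \<Rightarrow> complex"
  assumes scaleC_add_right: "c *\<^sub>C (x + y) = c *\<^sub>C x + c *\<^sub>C y"
    and scaleC_add_left: "(c + d) *\<^sub>C x = c *\<^sub>C x + d *\<^sub>C x"
    and scaleC_scaleC: "c *\<^sub>C d *\<^sub>C x = (c * d) *\<^sub>C x"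
    and scaleC_of_real: "complex_of_real r *\<^sub>C x = r *\<^sub>R x"
    and cinner_commute: "cinner x y = cnj (cinner y x)"
    and cinner_add_left: "cinner (x + y) z = cinner x z + cinner y z"
    and cinner_scaleC_left: "cinner (c *\<^sub>C x) y = c * cinner x y"
    and cinner_self: "cinner x x = complex_of_real ((norm x)\<^sup>2)"


section \<open>Bounded operators\<close>

definition bounded_clinear :: "('h::complex_hilbert \<Rightarrow> 'h) \<Rightarrow> bool" where
  "bounded_clinear A \<longleftrightarrow> bounded_linear A \<and> (\<forall>c x. A (c *\<^sub>C x) = c *\<^sub>C A x)"

definition cadjoint :: "('h::complex_hilbert \<Rightarrow> 'h) \<Rightarrow> 'h \<Rightarrow> 'h" where
  "cadjoint A = (THE B. \<forall>x y. cinner (A x) y = cinner x (B y))"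

definition positive_op :: "('h::complex_hilbert \<Rightarrow> 'h) \<Rightarrow> bool" where
  "positive_op A \<longleftrightarrow> bounded_clinear A \<and> (\<forall>x. cinner (A x) x \<in> \<real>\<^sub>\<ge>\<^sub>0)"

definition op_sqrt :: "('h::complex_hilbert \<Rightarrow> 'h) \<Rightarrow> 'h \<Rightarrow> 'h" where
  "op_sqrt A = (THE B. positive_op B \<and> B \<circ> B = A)"

definition op_abs :: "('h::complex_hilbert \<Rightarrow> 'h) \<Rightarrow> 'h \<Rightarrow> 'h" where
  "op_abs A = op_sqrt (cadjoint A \<circ> A)"

definition op_Re :: "('h::complex_hilbert \<Rightarrow> 'h) \<Rightarrow> 'h \<Rightarrow> 'h" where
  "op_Re A = (\<lambda>x. (1 / 2) *\<^sub>C (A x + cadjoint A x))"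

definition op_Im :: "('h::complex_hilbert \<Rightarrow> 'h) \<Rightarrow> 'h \<Rightarrow> 'h" where
  "op_Im A = (\<lambda>x. (1 / (2 * \<i>)) *\<^sub>C (A x - cadjoint A x))"


section \<open>Reproducing kernel Hilbert spaces\<close>

text \<open>
  A Hilbert space of functions on \<open>\<X>\<close> is given by a type \<open>'h\<close> together with the map \<open>ev\<close> sending
  \<open>f :: 'h\<close> to the function \<open>\<xi>\<in>\<X> \<mapsto> ev f \<xi>\<close>. This map is linear for the pointwise operations and
  injective, so it identifies \<open>'h\<close> with a linear space of functions on \<open>\<X>\<close>; the values of \<open>ev f\<close>
  outside \<open>\<X>\<close> play no role.
\<close>

definition rk :: "('h::complex_hilbert \<Rightarrow> 'x \<Rightarrow> complex) \<Rightarrow> 'x \<Rightarrow> 'h" where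
  "rk ev \<xi> = (THE k. \<forall>f. ev f \<xi> = cinner f k)"

definition rk_hat :: "('h::complex_hilbert \<Rightarrow> 'x \<Rightarrow> complex) \<Rightarrow> 'x \<Rightarrow> 'h" where
  "rk_hat ev \<xi> = rk ev \<xi> /\<^sub>R norm (rk ev \<xi>)"

locale rkhs =
  fixes \<X> :: "'x set" and ev :: "'h::complex_hilbert \<Rightarrow> 'x \<Rightarrow> complex"
  assumes nonempty: "\<X> \<noteq> {}"
    and ev_add: "\<xi> \<in> \<X> \<Longrightarrow> ev (f + g) \<xi> = ev f \<xi> + ev g \<xi>"
    and ev_scaleC: "\<xi> \<in> \<X> \<Longrightarrow> ev (c *\<^sub>C f) \<xi> = c * ev f \<xi>"
    and ev_inject: "(\<And>\<xi>. \<xi> \<in> \<X> \<Longrightarrow> ev f \<xi> = ev g \<xi>) \<Longrightarrow> f = g"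
    and separable: "separable_space (euclidean :: 'h topology)"
    and ev_continuous: "\<xi> \<in> \<X> \<Longrightarrow> continuous_on UNIV (\<lambda>f. ev f \<xi>)"
    and rk_nonzero: "\<xi> \<in> \<X> \<Longrightarrow> rk ev \<xi> \<noteq> 0"


section \<open>Berezin transform, range, number and norm\<close>

definition berezin_transform ::
    "('h::complex_hilbert \<Rightarrow> 'x \<Rightarrow> complex) \<Rightarrow> ('h \<Rightarrow> 'h) \<Rightarrow> 'x \<Rightarrow> complex" where
  "berezin_transform ev A \<xi> = cinner (A (rk_hat ev \<xi>)) (rk_hat ev \<xi>)"

definition Ber :: "'x set \<Rightarrow> ('h::complex_hilbert \<Rightarrow> 'x \<Rightarrow> complex) \<Rightarrow> ('h \<Rightarrow> 'h) \<Rightarrow> complex set" where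
  "Ber \<X> ev A = berezin_transform ev A ` \<X>"

text \<open>
  The two suprema below are taken in the reals; for bounded \<open>A\<close> and nonempty \<open>\<X>\<close> they range over
  nonempty sets bounded by the operator norm of \<open>A\<close>.
\<close>

definition ber :: "'x set \<Rightarrow> ('h::complex_hilbert \<Rightarrow> 'x \<Rightarrow> complex) \<Rightarrow> ('h \<Rightarrow> 'h) \<Rightarrow> real" where
  "ber \<X> ev A = (SUP \<xi>\<in>\<X>. cmod (berezin_transform ev A \<xi>))"

definition ber_norm :: "'x set \<Rightarrow> ('h::complex_hilbert \<Rightarrow> 'x \<Rightarrow> complex) \<Rightarrow> ('h \<Rightarrow> 'h) \<Rightarrow> real" where
  "ber_norm \<X> ev A = (SUP (\<xi>, \<mu>)\<in>\<X> \<times> \<X>. cmod (cinner (A (rk_hat ev \<xi>)) (rk_hat ev \<mu>)))"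

definition sector :: "real \<Rightarrow> complex set" where
  "sector \<theta> = {z. z = 0 \<or> \<bar>Arg z\<bar> \<le> \<theta>}"

definition sectorial_Ber ::
    "'x set \<Rightarrow> ('h::complex_hilbert \<Rightarrow> 'x \<Rightarrow> complex) \<Rightarrow> real \<Rightarrow> ('h \<Rightarrow> 'h) set" where
  "sectorial_Ber \<X> ev \<theta> = {A. bounded_clinear A \<and> Ber \<X> ev A \<subseteq> sector \<theta>}"

definition sectorial_Ber_P ::
    "'x set \<Rightarrow> ('h::complex_hilbert \<Rightarrow> 'x \<Rightarrow> complex) \<Rightarrow> real \<Rightarrow> ('h \<Rightarrow> 'h) set" where
  "sectorial_Ber_P \<X> ev \<theta> = {A \<in> sectorial_Ber \<X> ev \<theta>.
     \<forall>n::nat. ber \<X> ev (op_Re A ^^ n) \<le> ber \<X> ev (op_Re A) ^ n \<and>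
              ber \<X> ev (op_Im A ^^ n) \<le> ber \<X> ev (op_Im A) ^ n}"

end

theory Submission
  imports Defs
begin

text \<open>
  Let \<open>x\<close> be a normalised kernel. By the Cauchy-Schwarz inequality, first in the Hilbert space and
  then in the plane, \<open>\<bar>\<langle>(SXT \<plusminus> TYS)x, x\<rangle>\<bar> \<le> \<parallel>XTx\<parallel> \<parallel>S\<^sup>*x\<parallel> + \<parallel>Y\<^sup>*T\<^sup>*x\<parallel> \<parallel>Sx\<parallel>\<close> is at most the product
  of the square roots of \<open>\<langle>(T\<^sup>*|X|\<^sup>2T + T|Y\<^sup>*|\<^sup>2T\<^sup>*)x, x\<rangle>\<close> and
  \<open>\<parallel>Sx\<parallel>\<^sup>2 + \<parallel>S\<^sup>*x\<parallel>\<^sup>2 = 2 \<langle>(Re\<^sup>2 S + Im\<^sup>2 S)x, x\<rangle> \<le> 2 (ber\<^sup>2 (Re S) + ber\<^sup>2 (Im S))\<close>. Bounding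
  \<open>4 * ber\<^sup>2 (Im S)\<close> by \<open>4 * sin\<^sup>2 \<theta> * ber\<^sup>2 S\<close> in this turns it into the second factor of the claim;
  indeed \<open>ber (Im S) \<le> sin \<theta> * ber S\<close>, because \<open>\<bar>Im z\<bar> \<le> sin \<theta> * \<bar>z\<bar>\<close> in the sector.
\<close>


section \<open>Inner product\<close>

lemma cinner_add_right: "cinner x (y + z) = cinner x y + cinner x (z::'a::complex_hilbert)"
  by (metis cinner_add_left cinner_commute complex_cnj_add)

lemma cinner_scaleC_right: "cinner x (c *\<^sub>C y) = cnj c * cinner x (y::'a::complex_hilbert)"
  by (metis cinner_scaleC_left cinner_commute complex_cnj_mult)

lemma scaleC_minus1: "(-1) *\<^sub>C x = - (x::'a::complex_hilbert)"
  using scaleC_of_real[of "-1" x] by simp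

lemma cinner_minus_left: "cinner (- x) y = - cinner x (y::'a::complex_hilbert)"
  using cinner_scaleC_left[of "-1" x y] by (simp add: scaleC_minus1)

lemma cinner_minus_right: "cinner x (- y) = - cinner x (y::'a::complex_hilbert)"
  using cinner_scaleC_right[of x "-1" y] by (simp add: scaleC_minus1)

lemma cinner_diff_left: "cinner (x - y) z = cinner x z - cinner y (z::'a::complex_hilbert)"
  using cinner_add_left[of x "- y" z] by (simp add: cinner_minus_left)

lemma cinner_diff_right: "cinner x (y - z) = cinner x y - cinner x (z::'a::complex_hilbert)"
  using cinner_add_right[of x y "- z"] by (simp add: cinner_minus_right)

lemma cinner_scaleR_left: "cinner (r *\<^sub>R x) y = of_real r * cinner x (y::'a::complex_hilbert)"
  by (metis cinner_scaleC_left scaleC_of_real)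

lemma cinner_scaleR_right: "cinner x (r *\<^sub>R y) = of_real r * cinner x (y::'a::complex_hilbert)"
  by (metis cinner_scaleC_right complex_cnj_complex_of_real scaleC_of_real)

lemma cinner_zero_left [simp]: "cinner 0 (y::'a::complex_hilbert) = 0"
  using cinner_scaleR_left[of 0 0 y] by simp

lemma cinner_zero_right [simp]: "cinner (y::'a::complex_hilbert) 0 = 0"
  using cinner_scaleR_right[of y 0 0] by simp

lemmas cinner_simps = cinner_add_left cinner_add_right cinner_diff_left cinner_diff_right
  cinner_scaleR_left cinner_scaleR_right cinner_scaleC_left cinner_scaleC_right
  cinner_minus_left cinner_minus_right

lemma Re_cinner_commute: "Re (cinner x y) = Re (cinner y (x::'a::complex_hilbert))"
  by (metis cinner_commute complex_cnj(1) complex.sel(1) complex_surj)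

lemma norm_add_square:
  "(norm (x + y))\<^sup>2 = (norm x)\<^sup>2 + 2 * Re (cinner x y) + (norm (y::'a::complex_hilbert))\<^sup>2"
proof -
  have "Re (cinner (x + y) (x + y)) = (norm x)\<^sup>2 + 2 * Re (cinner x y) + (norm y)\<^sup>2"
    using Re_cinner_commute[of y x]
    by (simp add: cinner_add_left cinner_add_right) (simp add: cinner_self del: of_real_power)
  thus ?thesis by (simp add: cinner_self del: of_real_power)
qed

lemma norm_diff_square:
  "(norm (x - y))\<^sup>2 = (norm x)\<^sup>2 - 2 * Re (cinner x y) + (norm (y::'a::complex_hilbert))\<^sup>2"
  using norm_add_square[of x "- y"] by (simp add: cinner_minus_right)

lemma parallelogram_law:
  "(norm (x + y))\<^sup>2 + (norm (x - y))\<^sup>2 = 2 * (norm x)\<^sup>2 + 2 * (norm (y::'a::complex_hilbert))\<^sup>2"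
  by (simp add: norm_add_square norm_diff_square)

lemma cnj_mult_self: "cnj z * z = (of_real (cmod z))\<^sup>2" "z * cnj z = (of_real (cmod z))\<^sup>2"
  by (metis complex_norm_square mult.commute of_real_power)+

text \<open>A real Banach norm is homogeneous for real scalars; for complex ones this has to be
  extracted from \<open>cinner_self\<close>.\<close>

lemma norm_scaleC: "norm (c *\<^sub>C x) = cmod c * norm (x::'a::complex_hilbert)"
proof -
  have "complex_of_real ((norm (c *\<^sub>C x))\<^sup>2) = of_real ((cmod c * norm x)\<^sup>2)"
    unfolding cinner_self[symmetric] cinner_scaleC_left cinner_scaleC_right
    by (simp add: cinner_self power_mult_distrib cnj_mult_self mult.assoc[symmetric])
  thus ?thesis
    by (metis norm_ge_zero of_real_eq_iff power2_eq_imp_eq mult_nonneg_nonneg)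
qed

lemma cinner_self_eq_0: "cinner x x = 0 \<longleftrightarrow> (x::'a::complex_hilbert) = 0"
  by (simp add: cinner_self)

lemma cinner_Cauchy_Schwarz: "cmod (cinner x y) \<le> norm x * norm (y::'a::complex_hilbert)"
proof (cases "y = 0")
  case False
  \<comment> \<open>\<open>c *\<^sub>C y\<close> is the orthogonal projection of \<open>x\<close>
    onto the line through \<open>y\<close>, the choice that minimises the norm expanded
    below.\<close>
  define c where "c = cinner x y / of_real ((norm y)\<^sup>2)"
  have "0 \<le> (norm (x - c *\<^sub>C y))\<^sup>2" by simp
  also have "\<dots> = (norm x)\<^sup>2 - 2 * Re (cnj c * cinner x y) + (cmod c)\<^sup>2 * (norm y)\<^sup>2"
    by (simp add: norm_diff_square cinner_scaleC_right norm_scaleC power_mult_distrib)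
  also have "cnj c * cinner x y = of_real ((cmod (cinner x y))\<^sup>2 / (norm y)\<^sup>2)"
    unfolding c_def by (simp add: cnj_mult_self)
  also have "(cmod c)\<^sup>2 * (norm y)\<^sup>2 = (cmod (cinner x y))\<^sup>2 / (norm y)\<^sup>2"
    unfolding c_def using False by (simp add: norm_divide power_divide power2_eq_square norm_mult)
  finally have "(cmod (cinner x y))\<^sup>2 / (norm y)\<^sup>2 \<le> (norm x)\<^sup>2" by simp
  hence "(cmod (cinner x y))\<^sup>2 \<le> (norm x * norm y)\<^sup>2"
    using False by (simp add: divide_le_eq power_mult_distrib)
  thus ?thesis by (rule power2_le_imp_le) simp
qed simp

lemma bounded_linear_cinner_left: "bounded_linear (\<lambda>x. cinner x (y::'a::complex_hilbert))"
  by (rule bounded_linear_intro[where K="norm y"])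
    (simp_all add: cinner_simps cinner_Cauchy_Schwarz scaleR_conv_of_real)

lemma bounded_linear_cinner_right: "bounded_linear (\<lambda>y. cinner (x::'a::complex_hilbert) y)"
  by (rule bounded_linear_intro[where K="norm x"])
    (simp_all add: cinner_simps cinner_Cauchy_Schwarz[of x, unfolded mult.commute[of "norm x"]]
      scaleR_conv_of_real)

lemma bounded_linear_scaleC: "bounded_linear (\<lambda>x. c *\<^sub>C (x::'a::complex_hilbert))"
  by (rule bounded_linear_intro[where K="cmod c"])
    (simp_all add: scaleC_add_right norm_scaleC mult.commute scaleC_scaleC flip: scaleC_of_real)

lemma cinner_ext: "(\<And>x. cinner x y = cinner x z) \<Longrightarrow> y = (z::'a::complex_hilbert)"
  using cinner_self_eq_0[of "y - z"] by (simp add: cinner_diff_right)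


section \<open>Riesz representation and adjoints\<close>

text \<open>The representing vector minimises \<open>\<lambda>x. \<parallel>x\<parallel>\<^sup>2 - 2 * Re (f x)\<close>.\<close>

lemma riesz_representation:
  fixes f :: "'a::complex_hilbert \<Rightarrow> complex"
  assumes f: "bounded_linear f" and fC: "\<And>c x. f (c *\<^sub>C x) = c * f x"
  shows "\<exists>z. \<forall>x. f x = cinner x z"
proof -
  interpret f: bounded_linear f by (rule f)
  obtain K where K: "\<And>x. cmod (f x) \<le> norm x * K" using f.bounded by blast
  define q where "q x = (norm x)\<^sup>2 - 2 * Re (f x)" for x
  have q_lb: "- K\<^sup>2 \<le> q x" for x
  proof -
    have "Re (f x) \<le> norm x * K" using K[of x] complex_Re_le_cmod[of "f x"] by linarith
    moreover have "0 \<le> (norm x - K)\<^sup>2" by simp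
    ultimately show ?thesis unfolding q_def by (simp add: power2_diff)
  qed
  define m where "m = Inf (range q)"
  have bdd: "bdd_below (range q)" using q_lb by (intro bdd_belowI2)
  have m_le: "m \<le> q x" for x unfolding m_def by (rule cInf_lower[OF _ bdd]) simp
  have "\<exists>x. q x < m + 1 / real (Suc n)" for n
  proof -
    have "Inf (range q) < m + 1 / real (Suc n)" by (simp add: m_def)
    thus ?thesis using cInf_less_iff[OF _ bdd] by auto
  qed
  then obtain X where X: "\<And>n. q (X n) < m + 1 / real (Suc n)" by metis
  \<comment> \<open>In the parallelogram law the linear parts of \<open>q\<close> cancel. As the
    midpoint value is at least \<open>m\<close>, near-minimisers are close to each other.\<close>
  have mid: "(norm (x - y))\<^sup>2 = 2 * q x + 2 * q y - 4 * q ((1 / 2) *\<^sub>R (x + y))" for x y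
    using parallelogram_law[of x y]
    by (simp only: q_def f.add f.scaleR norm_scaleR) (simp add: power_divide field_simps)
  have dist_bound: "(norm (x - y))\<^sup>2 \<le> 2 * (q x - m) + 2 * (q y - m)" for x y
    using mid[of x y] m_le[of "(1 / 2) *\<^sub>R (x + y)"] by simp
  have "Cauchy X"
  proof (rule CauchyI)
    fix e :: real assume e: "0 < e"
    obtain N where N: "1 / real (Suc N) < e\<^sup>2 / 4"
      using nat_approx_posE[of "e\<^sup>2 / 4"] e by auto
    have small: "q (X n) - m < e\<^sup>2 / 4" if "N \<le> n" for n
    proof -
      have "1 / real (Suc n) \<le> 1 / real (Suc N)" using that by (simp add: field_simps)
      thus ?thesis using X[of n] N by simp
    qed
    have "norm (X a - X b) < e" if "N \<le> a" "N \<le> b" for a b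
    proof (rule power2_less_imp_less)
      show "(norm (X a - X b))\<^sup>2 < e\<^sup>2"
        using dist_bound[of "X a" "X b"] small[OF that(1)] small[OF that(2)] by simp
    qed (use e in simp)
    thus "\<exists>N. \<forall>a\<ge>N. \<forall>b\<ge>N. norm (X a - X b) < e" by blast
  qed
  then obtain z where z: "X \<longlonglongrightarrow> z" using Cauchy_convergent convergent_def by blast
  have "(\<lambda>n. q (X n)) \<longlonglongrightarrow> q z"
    unfolding q_def by (intro tendsto_intros f.tendsto z)
  moreover have "(\<lambda>n. m + 1 / real (Suc n)) \<longlonglongrightarrow> m + 0"
    by (intro tendsto_intros LIMSEQ_Suc[OF lim_1_over_n])
  ultimately have "q z \<le> m + 0"
    using X by (intro LIMSEQ_le[where X="\<lambda>n. q (X n)"]) (auto intro: less_imp_le)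
  hence qz: "q z \<le> q x" for x using m_le[of x] by simp
  have Re_eq: "Re (f h) = Re (cinner h z)" for h
  proof -
    define a where "a = Re (cinner h z) - Re (f h)"
    \<comment> \<open>Minimality of \<open>z\<close> in the direction \<open>h\<close> makes a
      quadratic in \<open>t\<close> nonnegative; the choice \<open>t = - a / b\<close> then forces
      \<open>a = 0\<close>. The summand \<open>1\<close> keeps \<open>b\<close> positive at
      \<open>h = 0\<close>.\<close>
    define b where "b = (norm h)\<^sup>2 + 1"
    define t where "t = - a / b"
    have b: "b > 0" by (simp add: b_def add_nonneg_pos)
    have "q (z + t *\<^sub>R h) = q z + 2 * t * a + t\<^sup>2 * (norm h)\<^sup>2"
      using Re_cinner_commute[of z h]
      by (simp add: q_def norm_add_square cinner_simps f.add f.scaleR a_def power_mult_distrib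
          algebra_simps)
    moreover have "t\<^sup>2 * (norm h)\<^sup>2 \<le> t\<^sup>2 * b" by (intro mult_left_mono) (auto simp: b_def)
    ultimately have "0 \<le> 2 * t * a + t\<^sup>2 * b" using qz[of "z + t *\<^sub>R h"] by linarith
    also have "\<dots> = - a\<^sup>2 / b" using b by (simp add: t_def power2_eq_square field_simps)
    finally have "a\<^sup>2 \<le> 0" using b by (simp add: divide_le_0_iff)
    thus ?thesis by (simp add: a_def)
  qed
  \<comment> \<open>For both functionals, the real part at \<open>\<i> *\<^sub>C h\<close> is minus
    the imaginary part at \<open>h\<close>.\<close>
  have "f h = cinner h z" for h
    using Re_eq[of h] Re_eq[of "\<i> *\<^sub>C h"]
    by (simp add: fC cinner_scaleC_left complex_eq_iff)
  thus ?thesis by blast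
qed

section \<open>Bounded complex-linear operators and their adjoints\<close>

lemma bounded_clinear_bounded_linear: "bounded_clinear A \<Longrightarrow> bounded_linear A"
  by (simp add: bounded_clinear_def)

lemma bounded_clinear_scaleC: "bounded_clinear A \<Longrightarrow> A (c *\<^sub>C x) = c *\<^sub>C A x"
  by (simp add: bounded_clinear_def)

lemma bounded_clinear_comp:
  "bounded_clinear A \<Longrightarrow> bounded_clinear B \<Longrightarrow> bounded_clinear (A \<circ> B)"
  using bounded_linear_compose[of A B] by (simp add: bounded_clinear_def o_def)

lemma bounded_clinear_add:
  "bounded_clinear A \<Longrightarrow> bounded_clinear B \<Longrightarrow> bounded_clinear (\<lambda>x. A x + B x)"
  by (simp add: bounded_clinear_def bounded_linear_add scaleC_add_right)

lemma bounded_clinear_const_scaleC: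
  "bounded_clinear A \<Longrightarrow> bounded_clinear (\<lambda>x. c *\<^sub>C A x)"
  using bounded_linear_compose[OF bounded_linear_scaleC[of c], of A]
  by (simp add: bounded_clinear_def scaleC_scaleC mult.commute)

lemma bounded_clinear_diff:
  assumes "bounded_clinear A" "bounded_clinear B"
  shows "bounded_clinear (\<lambda>x. A x - B x)"
  using bounded_clinear_add[OF assms(1) bounded_clinear_const_scaleC[OF assms(2), of "-1"]]
  by (simp add: scaleC_minus1)

lemma cadjoint_unique:
  assumes "\<And>x y. cinner (A x) y = cinner x (B y)"
  shows "cadjoint A = B"
  unfolding cadjoint_def
proof (rule the_equality)
  fix C assume "\<forall>x y. cinner (A x) y = cinner x (C y)"
  thus "C = B" using assms by (intro ext cinner_ext) metis
qed (use assms in blast)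

text \<open>Riesz representation for each fixed \<open>y\<close>, followed by a choice of one vector
  per \<open>y\<close>, gives a map that \<open>cadjoint_unique\<close> identifies with
  \<open>cadjoint A\<close>.\<close>

lemma cinner_cadjoint:
  assumes A: "bounded_clinear A"
  shows "cinner (A x) y = cinner x (cadjoint A y)"
proof -
  have "\<exists>z. \<forall>x. cinner (A x) y = cinner x z" for y
    by (rule riesz_representation)
      (simp_all add: bounded_linear_compose[OF bounded_linear_cinner_left]
        bounded_clinear_bounded_linear[OF A] bounded_clinear_scaleC[OF A] cinner_scaleC_left)
  then obtain B where B: "\<And>x y. cinner (A x) y = cinner x (B y)" by metis
  thus ?thesis using cadjoint_unique[of A B] by metis
qed

lemma cinner_cadjoint':
  assumes A: "bounded_clinear A"
  shows "cinner (cadjoint A x) y = cinner x (A y)"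
  by (metis cinner_cadjoint[OF A] cinner_commute)

lemma bounded_clinear_cadjoint:
  assumes A: "bounded_clinear A"
  shows "bounded_clinear (cadjoint A)"
proof -
  obtain K where K: "\<And>x. norm (A x) \<le> norm x * K"
    using bounded_linear.bounded[OF bounded_clinear_bounded_linear[OF A]] by blast
  have scaleC: "cadjoint A (c *\<^sub>C y) = c *\<^sub>C cadjoint A y" for c y
    by (rule cinner_ext) (simp add: cinner_simps flip: cinner_cadjoint[OF A])
  have bound: "norm (cadjoint A y) \<le> norm y * K" for y
  proof (cases "cadjoint A y = 0")
    case True
    \<comment> \<open>\<open>K\<close> comes without a sign; the bound on \<open>A y\<close> shows
      that \<open>norm y * K\<close> is nonnegative.\<close>
    thus ?thesis using order_trans[OF norm_ge_zero K[of y]] by simp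
  next
    case False
    have "(norm (cadjoint A y))\<^sup>2 = cmod (cinner (A (cadjoint A y)) y)"
      by (simp add: cinner_cadjoint[OF A] cinner_self norm_power)
    also have "\<dots> \<le> norm (A (cadjoint A y)) * norm y" by (rule cinner_Cauchy_Schwarz)
    also have "\<dots> \<le> norm (cadjoint A y) * K * norm y" by (intro mult_right_mono K) simp
    finally show ?thesis using False by (simp add: power2_eq_square mult.commute mult.left_commute)
  qed
  have "bounded_linear (cadjoint A)"
  proof (rule bounded_linear_intro[where K=K])
    show "cadjoint A (x + y) = cadjoint A x + cadjoint A y" for x y
      by (rule cinner_ext) (simp add: cinner_simps flip: cinner_cadjoint[OF A])
    show "cadjoint A (r *\<^sub>R x) = r *\<^sub>R cadjoint A x" for r x
      using scaleC[of "of_real r" x] by (simp add: scaleC_of_real)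
  qed (rule bound)
  thus ?thesis using scaleC by (simp add: bounded_clinear_def)
qed

lemma cadjoint_cadjoint: "bounded_clinear A \<Longrightarrow> cadjoint (cadjoint A) = A"
  by (rule cadjoint_unique) (rule cinner_cadjoint')


section \<open>Square roots of positive operators\<close>

lemma positive_op_cinner:
  assumes "positive_op A"
  shows "cinner (A x) x = of_real (Re (cinner (A x) x))" "0 \<le> Re (cinner (A x) x)"
  using assms unfolding positive_op_def
  by (auto simp: complex_nonneg_Reals_iff complex_eq_iff)

text \<open>Polarisation: realness of the quadratic form at \<open>x + y\<close> relates imaginary
  parts, and replacing \<open>y\<close> by \<open>\<i> *\<^sub>C y\<close> relates real
  parts.\<close>

lemma positive_op_selfadjoint:
  assumes A: "positive_op A"
  shows "cinner (A x) y = cinner x (A y)"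
proof -
  have cl: "bounded_clinear A" using A by (simp add: positive_op_def)
  interpret bounded_linear A by (rule bounded_clinear_bounded_linear[OF cl])
  have Im0: "Im (cinner (A z) z) = 0" for z using positive_op_cinner(1)[OF A, of z]
    by (simp add: complex_eq_iff)
  have "Im (cinner (A x) y) + Im (cinner (A y) x) = 0" for x y
    using Im0[of "x + y"] Im0[of x] Im0[of y] by (simp add: add cinner_simps)
  from this[of x y] this[of x "\<i> *\<^sub>C y"] have "cinner (A x) y = cnj (cinner (A y) x)"
    by (simp add: bounded_clinear_scaleC[OF cl] cinner_simps complex_eq_iff)
  thus ?thesis by (metis cinner_commute)
qed

text \<open>Positivity is tested at \<open>K *\<^sub>R x - A x\<close>, and \<open>K\<close> bounds
  the quadratic form at \<open>A x\<close>. The estimate later makes \<open>1 - A / K\<close> a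
  contraction.\<close>

lemma positive_op_norm_square_le:
  assumes A: "positive_op A" and K: "\<And>x. norm (A x) \<le> norm x * K" "0 < K"
  shows "(norm (A x))\<^sup>2 \<le> K * Re (cinner (A x) x)"
proof -
  interpret bounded_linear A
    using A by (simp add: positive_op_def bounded_clinear_bounded_linear)
  define y where "y = A x"
  have "Re (cinner (A y) y) \<le> norm (A y) * norm y"
    using complex_Re_le_cmod cinner_Cauchy_Schwarz order_trans by blast
  also have "\<dots> \<le> K * (norm y)\<^sup>2"
    using mult_right_mono[OF K(1)[of y], of "norm y"] by (simp add: power2_eq_square mult_ac)
  finally have le: "Re (cinner (A y) y) \<le> K * (norm y)\<^sup>2" .
  have "0 \<le> Re (cinner (A (K *\<^sub>R x - y)) (K *\<^sub>R x - y))" by (rule positive_op_cinner(2)[OF A])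
  also have "\<dots> = K\<^sup>2 * Re (cinner y x) - 2 * K * (norm y)\<^sup>2 + Re (cinner (A y) y)"
    using positive_op_selfadjoint[OF A, of y x]
    by (simp add: y_def[symmetric] diff scaleR cinner_simps cinner_self power2_eq_square
        right_diff_distrib)
  finally have "K * (norm y)\<^sup>2 \<le> K * (K * Re (cinner y x))"
    using le by (simp add: power2_eq_square algebra_simps)
  thus ?thesis using K(2) by (simp add: y_def)
qed

lemma positive_op_eq_0:
  assumes A: "positive_op A" and "cinner (A x) x = 0"
  shows "A x = 0"
proof -
  obtain K where "0 < K" "\<And>x. norm (A x) \<le> norm x * K"
    using bounded_linear.pos_bounded A by (meson positive_op_def bounded_clinear_bounded_linear)
  thus ?thesis using positive_op_norm_square_le[OF A, of K x] assms(2) by simp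
qed

section \<open>Existence of the square root by a fixed-point iteration\<close>

text \<open>If \<open>Z\<close> is a fixed point of \<open>Y \<mapsto> (B + Y\<^sup>2) / 2\<close>, then \<open>(1 - Z)\<^sup>2 = 1 - B\<close>. For
  \<open>\<parallel>B\<parallel> \<le> 1\<close> the iteration converges in operator norm, since it is majorised by the same
  iteration for the scalar \<open>1\<close>.\<close>

primrec sqrt_iter :: "('a::real_normed_vector \<Rightarrow>\<^sub>L 'a) \<Rightarrow> nat \<Rightarrow> 'a \<Rightarrow>\<^sub>L 'a" where
  "sqrt_iter B 0 = 0"
| "sqrt_iter B (Suc n) = (1 / 2) *\<^sub>R (B + (sqrt_iter B n o\<^sub>L sqrt_iter B n))"

primrec sqrt_majorant :: "nat \<Rightarrow> real" where
  "sqrt_majorant 0 = 0"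
| "sqrt_majorant (Suc n) = (1 + (sqrt_majorant n)\<^sup>2) / 2"

lemma sqrt_majorant_bounds: "0 \<le> sqrt_majorant n \<and> sqrt_majorant n \<le> 1"
proof (induction n)
  case (Suc n)
  hence "(sqrt_majorant n)\<^sup>2 \<le> 1" by (simp add: power_le_one)
  thus ?case by simp
qed simp

lemma sqrt_majorant_mono: "incseq sqrt_majorant"
proof (rule incseq_SucI)
  fix n
  \<comment> \<open>Half of this square is the increment of the majorant.\<close>
  have "0 \<le> (1 - sqrt_majorant n)\<^sup>2" by simp
  thus "sqrt_majorant n \<le> sqrt_majorant (Suc n)" by (simp add: power2_diff)
qed

lemma norm_sqrt_iter_le:
  assumes "norm B \<le> 1"
  shows "norm (sqrt_iter B n) \<le> sqrt_majorant n"
proof (induction n)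
  case (Suc n)
  have "norm (sqrt_iter B n o\<^sub>L sqrt_iter B n) \<le> norm (sqrt_iter B n) * norm (sqrt_iter B n)"
    by (rule norm_blinfun_compose)
  also have "\<dots> \<le> (sqrt_majorant n)\<^sup>2"
    unfolding power2_eq_square using Suc sqrt_majorant_bounds[of n] by (intro mult_mono) auto
  finally show ?case
    using assms norm_triangle_ineq[of B "sqrt_iter B n o\<^sub>L sqrt_iter B n"] by simp
qed simp

text \<open>The factorisation V V - U U = (V - U) V + U (V - U) holds without commutativity, and its
  norm estimate collapses to the scalar v v - u u.\<close>

lemma norm_sqrt_iter_step:
  assumes B: "norm B \<le> 1"
  shows "norm (sqrt_iter B (Suc n) - sqrt_iter B n) \<le> sqrt_majorant (Suc n) - sqrt_majorant n"
proof (induction n)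
  case 0
  show ?case using B by simp
next
  case (Suc n)
  define U V u v where "U = sqrt_iter B n" and "V = sqrt_iter B (Suc n)"
    and "u = sqrt_majorant n" and "v = sqrt_majorant (Suc n)"
  have step: "norm (V - U) \<le> v - u" using Suc by (simp add: U_def V_def u_def v_def)
  have U: "norm U \<le> u" and V: "norm V \<le> v"
    using norm_sqrt_iter_le[OF B] by (simp_all only: U_def V_def u_def v_def)
  have "sqrt_iter B (Suc (Suc n)) - V = (1 / 2) *\<^sub>R ((V o\<^sub>L V) - (U o\<^sub>L U))"
    by (simp add: U_def V_def algebra_simps)
  also have "(V o\<^sub>L V) - (U o\<^sub>L U) = ((V - U) o\<^sub>L V) + (U o\<^sub>L (V - U))"
    by (rule blinfun_eqI) (simp add: blinfun.bilinear_simps)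
  finally have "norm (sqrt_iter B (Suc (Suc n)) - V) = norm (((V - U) o\<^sub>L V) + (U o\<^sub>L (V - U))) / 2"
    by simp
  also have "\<dots> \<le> (norm (V - U) * norm V + norm U * norm (V - U)) / 2"
    by (intro divide_right_mono norm_triangle_mono norm_blinfun_compose) simp
  also have "\<dots> \<le> ((v - u) * v + u * (v - u)) / 2"
    using step U V order_trans[OF norm_ge_zero U] order_trans[OF norm_ge_zero step]
    by (intro divide_right_mono add_mono mult_mono) auto
  also have "\<dots> = (v\<^sup>2 - u\<^sup>2) / 2" by (simp add: power2_eq_square algebra_simps)
  also have "\<dots> = sqrt_majorant (Suc (Suc n)) - v"
    by (simp add: u_def v_def diff_divide_distrib add_divide_distrib)
  finally show ?case by (simp only: V_def v_def)
qed

lemma norm_sqrt_iter_diff: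
  assumes B: "norm B \<le> 1" and "m \<le> n"
  shows "norm (sqrt_iter B n - sqrt_iter B m) \<le> sqrt_majorant n - sqrt_majorant m"
  using \<open>m \<le> n\<close>
proof (induction n rule: dec_induct)
  case (step n)
  thus ?case
    using norm_sqrt_iter_step[OF B, of n]
      norm_triangle_ineq[of "sqrt_iter B (Suc n) - sqrt_iter B n" "sqrt_iter B n - sqrt_iter B m"]
    by simp
qed simp

text \<open>The majorant is increasing and bounded, hence Cauchy, and this carries over to the
  iterates. The fixed-point equation is the recursion in the limit.\<close>

lemma sqrt_iter_convergent:
  fixes B :: "'a::banach \<Rightarrow>\<^sub>L 'a"
  assumes B: "norm B \<le> 1"
  obtains Z where "sqrt_iter B \<longlonglongrightarrow> Z" "norm Z \<le> 1" "Z = (1 / 2) *\<^sub>R (B + (Z o\<^sub>L Z))"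
proof -
  obtain y where "sqrt_majorant \<longlonglongrightarrow> y"
    using incseq_convergent[OF sqrt_majorant_mono, of 1] sqrt_majorant_bounds by blast
  hence cau: "Cauchy sqrt_majorant" by (rule LIMSEQ_imp_Cauchy)
  have le: "norm (sqrt_iter B m - sqrt_iter B n) \<le> norm (sqrt_majorant m - sqrt_majorant n)" for m n
    using norm_sqrt_iter_diff[OF B, of m n] norm_sqrt_iter_diff[OF B, of n m]
    by (cases "m \<le> n") (auto simp: norm_minus_commute)
  have "Cauchy (sqrt_iter B)"
  proof (rule CauchyI)
    fix e :: real assume "0 < e"
    then obtain N where "\<forall>m\<ge>N. \<forall>n\<ge>N. norm (sqrt_majorant m - sqrt_majorant n) < e"
      using CauchyD[OF cau] by blast
    thus "\<exists>N. \<forall>m\<ge>N. \<forall>n\<ge>N. norm (sqrt_iter B m - sqrt_iter B n) < e"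
      using le le_less_trans by blast
  qed
  then obtain Z where Z: "sqrt_iter B \<longlonglongrightarrow> Z" using Cauchy_convergent convergent_def by blast
  have "norm (sqrt_iter B n) \<le> 1" for n
    using norm_sqrt_iter_le[OF B, of n] sqrt_majorant_bounds[of n] by linarith
  hence "norm Z \<le> 1" using LIMSEQ_le_const2[OF tendsto_norm[OF Z]] by blast
  moreover have "(\<lambda>n. sqrt_iter B (Suc n)) \<longlonglongrightarrow> (1 / 2) *\<^sub>R (B + (Z o\<^sub>L Z))"
    unfolding sqrt_iter.simps
    by (intro tendsto_intros bounded_bilinear.tendsto[OF bounded_bilinear_blinfun_compose] Z)
  hence "Z = (1 / 2) *\<^sub>R (B + (Z o\<^sub>L Z))" by (rule LIMSEQ_unique[OF LIMSEQ_Suc[OF Z]])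
  ultimately show ?thesis using that Z by blast
qed

text \<open>The iterates are polynomials in \<open>B\<close>, so whatever commutes with
  \<open>B\<close> commutes with them.\<close>

lemma sqrt_iter_commute:
  fixes B :: "'a::real_normed_vector \<Rightarrow>\<^sub>L 'a"
  assumes C: "bounded_linear C" and "\<And>x. C (B x) = B (C x)"
  shows "C (sqrt_iter B n x) = sqrt_iter B n (C x)"
proof (induction n arbitrary: x)
  case 0
  show ?case using linear_simps[OF C] by simp
next
  case (Suc n)
  thus ?case using assms(2)
    by (simp add: linear_simps[OF C] blinfun.bilinear_simps)
qed

lemma sqrt_iter_selfadjoint:
  fixes B :: "'a::complex_hilbert \<Rightarrow>\<^sub>L 'a"
  assumes "\<And>x y. cinner (B x) y = cinner x (B y)"
  shows "cinner (sqrt_iter B n x) y = cinner x (sqrt_iter B n y)"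
proof (induction n arbitrary: x y)
  case (Suc n)
  thus ?case using assms by (simp add: cinner_simps blinfun.bilinear_simps)
qed simp

text \<open>With \<open>B = 1 - A / K\<close> and the fixed point \<open>Z\<close>, the root is
  \<open>sqrt K\<close> times \<open>1 - Z\<close>. The commutation clause is what the uniqueness
  proof will ask for.\<close>

lemma positive_sqrt_exists:
  assumes A: "positive_op A"
  obtains R where "positive_op R" "\<And>x. R (R x) = A x"
    "\<And>C x. bounded_linear C \<Longrightarrow> (\<And>x. C (A x) = A (C x)) \<Longrightarrow> C (R x) = R (C x)"
proof -
  have clA: "bounded_clinear A" using A by (simp add: positive_op_def)
  have lA: "bounded_linear A" by (rule bounded_clinear_bounded_linear[OF clA])
  obtain K where K: "0 < K" "\<And>x. norm (A x) \<le> norm x * K"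
    using bounded_linear.pos_bounded[OF lA] by blast
  define b where "b = (\<lambda>x. x - (1 / K) *\<^sub>R A x)"
  have lb: "bounded_linear b"
    unfolding b_def by (intro bounded_linear_intros lA)
  define B where "B = Blinfun b"
  have B: "blinfun_apply B x = x - (1 / K) *\<^sub>R A x" for x
    by (simp add: B_def bounded_linear_Blinfun_apply[OF lb]) (simp add: b_def)
  have "norm B \<le> 1"
  proof (rule norm_blinfun_bound)
    fix x
    have "(norm (B x))\<^sup>2 = (norm x)\<^sup>2 - 2 / K * Re (cinner (A x) x) + (norm (A x))\<^sup>2 / K\<^sup>2"
      using Re_cinner_commute[of x "A x"]
      by (simp add: B norm_diff_square cinner_simps power_divide)
    \<comment> \<open>The quadratic term is absorbed by half of the linear one.\<close>
    also have "(norm (A x))\<^sup>2 / K\<^sup>2 \<le> 1 / K * Re (cinner (A x) x)"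
      using positive_op_norm_square_le[OF A K(2,1), of x] K(1)
      by (simp add: field_simps power2_eq_square)
    finally have "(norm (B x))\<^sup>2 \<le> (norm x)\<^sup>2 - 1 / K * Re (cinner (A x) x)" by simp
    also have "\<dots> \<le> (norm x)\<^sup>2" using positive_op_cinner(2)[OF A, of x] K(1) by simp
    finally show "norm (B x) \<le> 1 * norm x" using power2_le_imp_le[of "norm (B x)" "norm x"] by simp
  qed simp
  then obtain Z where Z: "sqrt_iter B \<longlonglongrightarrow> Z" "norm Z \<le> 1" "Z = (1 / 2) *\<^sub>R (B + (Z o\<^sub>L Z))"
    by (rule sqrt_iter_convergent)
  have Zx: "(\<lambda>n. sqrt_iter B n x) \<longlonglongrightarrow> Z x" for x
    by (rule blinfun.tendsto[OF Z(1) tendsto_const])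
  have Z_comm: "C (Z x) = Z (C x)" if C: "bounded_linear C" and "\<And>x. C (A x) = A (C x)" for C x
  proof -
    have CB: "C (B x) = B (C x)" for x
      using that(2) by (simp add: B linear_simps[OF C])
    have "(\<lambda>n. C (sqrt_iter B n x)) \<longlonglongrightarrow> C (Z x)" by (rule bounded_linear.tendsto[OF C Zx])
    moreover have "(\<lambda>n. C (sqrt_iter B n x)) \<longlonglongrightarrow> Z (C x)"
      unfolding sqrt_iter_commute[OF C CB] by (rule Zx)
    ultimately show ?thesis by (rule LIMSEQ_unique)
  qed
  have Z_sa: "cinner (Z x) y = cinner x (Z y)" for x y
  proof -
    have B_sa: "cinner (B x) y = cinner x (B y)" for x y
      by (simp add: B cinner_simps positive_op_selfadjoint[OF A])
    have "(\<lambda>n. cinner (sqrt_iter B n x) y) \<longlonglongrightarrow> cinner (Z x) y"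
      by (rule bounded_linear.tendsto[OF bounded_linear_cinner_left Zx])
    moreover have "(\<lambda>n. cinner (sqrt_iter B n x) y) \<longlonglongrightarrow> cinner x (Z y)"
      unfolding sqrt_iter_selfadjoint[OF B_sa]
      by (rule bounded_linear.tendsto[OF bounded_linear_cinner_right Zx])
    ultimately show ?thesis by (rule LIMSEQ_unique)
  qed
  \<comment> \<open>\<open>Z\<close> is a limit of real-linear maps; complex homogeneity follows
    because multiplication by \<open>c\<close> commutes with \<open>A\<close>.\<close>
  have Z_scaleC: "Z (c *\<^sub>C x) = c *\<^sub>C Z x" for c x
    using Z_comm[OF bounded_linear_scaleC[of c], of x] bounded_clinear_scaleC[OF clA] by simp
  define R where "R = (\<lambda>x. sqrt K *\<^sub>R (x - Z x))"
  have clR: "bounded_clinear R"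
    unfolding bounded_clinear_def
  proof
    show "bounded_linear R"
      unfolding R_def by (intro bounded_linear_intros)
    show "\<forall>c x. R (c *\<^sub>C x) = c *\<^sub>C R x"
    proof (intro allI)
      fix c x
      have "R (c *\<^sub>C x) = sqrt K *\<^sub>R (c *\<^sub>C (x - Z x))"
        by (simp add: R_def Z_scaleC linear_simps[OF bounded_linear_scaleC])
      also have "\<dots> = c *\<^sub>C R x"
        unfolding R_def by (simp only: linear_simps[OF bounded_linear_scaleC])
      finally show "R (c *\<^sub>C x) = c *\<^sub>C R x" .
    qed
  qed
  have "cinner (R x) x \<in> \<real>\<^sub>\<ge>\<^sub>0" for x
  proof -
    have "cinner (Z x) x = cnj (cinner (Z x) x)" by (metis Z_sa cinner_commute)
    hence "Im (cinner (Z x) x) = 0" by (simp add: complex_eq_iff)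
    \<comment> \<open>This is positivity of \<open>1 - Z\<close>, a consequence of
      \<open>norm Z \<le> 1\<close>.\<close>
    moreover have "Re (cinner (Z x) x) \<le> (norm x)\<^sup>2"
    proof -
      have "Re (cinner (Z x) x) \<le> norm (Z x) * norm x"
        using complex_Re_le_cmod cinner_Cauchy_Schwarz order_trans by blast
      also have "norm (Z x) \<le> norm x"
        using norm_blinfun[of Z x] mult_right_mono[OF Z(2), of "norm x"] by simp
      finally show ?thesis by (simp add: power2_eq_square mult_right_mono)
    qed
    ultimately show ?thesis
      using K(1) by (simp add: R_def cinner_simps cinner_self complex_nonneg_Reals_iff del: of_real_power)
  qed
  with clR have "positive_op R" by (simp add: positive_op_def)
  moreover have "R (R x) = A x" for x
  proof -
    \<comment> \<open>The fixed-point equation, rearranged below to (1 - Z)(1 - Z) = 1 - B = A /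
      K.\<close>
    have "2 *\<^sub>R Z x = B x + Z (Z x)"
      by (subst Z(3)) (simp add: blinfun.bilinear_simps)
    hence "x - Z x - Z (x - Z x) = (1 / K) *\<^sub>R A x"
      by (simp add: B blinfun.bilinear_simps scaleR_2 algebra_simps)
    moreover have "R (R x) = K *\<^sub>R (x - Z x - Z (x - Z x))"
      using K(1) by (simp add: R_def blinfun.bilinear_simps flip: scaleR_diff_right)
    ultimately show ?thesis using K(1) by simp
  qed
  moreover have "C (R x) = R (C x)"
    if "bounded_linear C" "\<And>x. C (A x) = A (C x)" for C x
    using Z_comm[OF that, of x]
    by (simp add: R_def linear_simps[OF that(1)])
  ultimately show ?thesis using that by blast
qed

text \<open>For y = (P - R) x commutation gives (P + R) y = 0, so both nonnegative forms vanish at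
  y. Then P y = R y = 0, and y is orthogonal to itself.\<close>

lemma positive_sqrt_unique:
  assumes P: "positive_op P" and R: "positive_op R"
    and sq: "\<And>x. P (P x) = R (R x)" and comm: "\<And>x. P (R x) = R (P x)"
  shows "P = R"
proof
  fix x
  interpret P: bounded_linear P
    using P by (simp add: positive_op_def bounded_clinear_bounded_linear)
  interpret R: bounded_linear R
    using R by (simp add: positive_op_def bounded_clinear_bounded_linear)
  define y where "y = P x - R x"
  have "cinner (P y) y + cinner (R y) y = cinner (P y + R y) y" by (simp add: cinner_simps)
  also have "P y + R y = 0" by (simp add: y_def P.diff R.diff sq comm)
  finally have "Re (cinner (P y) y) + Re (cinner (R y) y) = 0"
    by (metis cinner_zero_left plus_complex.sel(1) zero_complex.sel(1))
  hence "Re (cinner (P y) y) = 0" "Re (cinner (R y) y) = 0"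
    using positive_op_cinner(2)[OF P, of y] positive_op_cinner(2)[OF R, of y] by linarith+
  hence "cinner (P y) y = 0" "cinner (R y) y = 0"
    using positive_op_cinner(1)[OF P, of y] positive_op_cinner(1)[OF R, of y] by simp_all
  hence "P y = 0" "R y = 0" using positive_op_eq_0 P R by blast+
  moreover have "cinner y y = cinner x (P y - R y)"
    using positive_op_selfadjoint[OF P, of x y] positive_op_selfadjoint[OF R, of x y]
    by (subst (1) y_def) (simp add: cinner_simps)
  ultimately have "y = 0" by (simp add: cinner_self_eq_0)
  thus "P x = R x" by (simp add: y_def)
qed

lemma op_sqrt_square:
  assumes A: "positive_op A"
  shows "op_sqrt A \<circ> op_sqrt A = A"
proof -
  obtain R where R: "positive_op R" "\<And>x. R (R x) = A x"
    "\<And>C x. bounded_linear C \<Longrightarrow> (\<And>x. C (A x) = A (C x)) \<Longrightarrow> C (R x) = R (C x)"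
    using positive_sqrt_exists[OF A] by blast
  have "\<exists>!P. positive_op P \<and> P \<circ> P = A"
  proof (rule ex1I[of _ R])
    show "positive_op R \<and> R \<circ> R = A" using R by (auto simp: fun_eq_iff)
    fix P assume P: "positive_op P \<and> P \<circ> P = A"
    hence sq: "P (P x) = A x" for x by (auto simp: fun_eq_iff)
    \<comment> \<open>\<open>P\<close> commutes with its own square \<open>A\<close>, hence with
      \<open>R\<close>.\<close>
    have "P (R x) = R (P x)" for x
      by (rule R(3)) (use P in \<open>auto simp: positive_op_def bounded_clinear_bounded_linear sq[symmetric]\<close>)
    thus "P = R" using P R sq by (intro positive_sqrt_unique) auto
  qed
  from theI'[OF this] show ?thesis by (simp add: op_sqrt_def)
qed

text \<open>Removes the absolute values from the theorem, where they occur only squared.\<close>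

lemma op_abs_square:
  assumes A: "bounded_clinear A"
  shows "op_abs A ^^ 2 = cadjoint A \<circ> A"
proof -
  have "positive_op (cadjoint A \<circ> A)"
    unfolding positive_op_def
    using A by (auto intro!: bounded_clinear_comp bounded_clinear_cadjoint
        simp: cinner_cadjoint' cinner_self complex_nonneg_Reals_iff simp del: of_real_power)
  from op_sqrt_square[OF this] show ?thesis by (simp add: op_abs_def numeral_2_eq_2)
qed


section \<open>Real and imaginary parts, Berezin number\<close>

lemma bounded_clinear_op_Re: "bounded_clinear A \<Longrightarrow> bounded_clinear (op_Re A)"
  unfolding op_Re_def
  by (intro bounded_clinear_const_scaleC bounded_clinear_add bounded_clinear_cadjoint)

lemma bounded_clinear_op_Im: "bounded_clinear A \<Longrightarrow> bounded_clinear (op_Im A)"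
  unfolding op_Im_def
  by (intro bounded_clinear_const_scaleC bounded_clinear_diff bounded_clinear_cadjoint)

lemma op_Re_selfadjoint: "bounded_clinear A \<Longrightarrow> cinner (op_Re A x) y = cinner x (op_Re A y)"
  by (simp add: op_Re_def cinner_simps cinner_cadjoint cinner_cadjoint')

lemma op_Im_selfadjoint: "bounded_clinear A \<Longrightarrow> cinner (op_Im A x) y = cinner x (op_Im A y)"
  by (simp add: op_Im_def cinner_simps cinner_cadjoint cinner_cadjoint' field_simps)

text \<open>Parallelogram law for \<open>A x\<close> and \<open>cadjoint A x\<close>, whose half-sum
  and half-difference have the norms on the right.\<close>

lemma norm_op_Re_Im_square:
  "(norm (A x))\<^sup>2 + (norm (cadjoint A x))\<^sup>2 = 2 * ((norm (op_Re A x))\<^sup>2 + (norm (op_Im A x))\<^sup>2)"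
  using parallelogram_law[of "A x" "cadjoint A x"]
  by (simp add: op_Re_def op_Im_def norm_scaleC norm_divide norm_mult power_divide)

lemma cinner_op_Im:
  assumes "bounded_clinear A"
  shows "cinner (op_Im A x) x = of_real (Im (cinner (A x) x))"
proof -
  have "cinner (cadjoint A x) x = cnj (cinner (A x) x)"
    by (metis assms cinner_cadjoint' cinner_commute)
  thus ?thesis by (simp add: op_Im_def cinner_simps complex_eq_iff)
qed

text \<open>In polar form the left side is \<open>cmod z * sin \<bar>Arg z\<bar>\<close>, and sine
  increases up to \<open>pi / 2\<close>.\<close>

lemma sector_Im_le:
  assumes "z \<in> sector \<theta>" "0 < \<theta>" "\<theta> < pi / 2"
  shows "\<bar>Im z\<bar> \<le> sin \<theta> * cmod z"
proof (cases "z = 0")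
  case False
  hence arg: "\<bar>Arg z\<bar> \<le> \<theta>" using assms(1) by (simp add: sector_def)
  have "\<bar>sin (Arg z)\<bar> = sin \<bar>Arg z\<bar>"
    using arg assms(3) sin_ge_zero[of "\<bar>Arg z\<bar>"] by (cases "0 \<le> Arg z") auto
  also have "\<dots> \<le> sin \<theta>" using arg assms(2,3) by (intro sin_monotone_2pi_le) auto
  finally have "\<bar>sin (Arg z)\<bar> \<le> sin \<theta>" .
  moreover have "Im z = cmod z * sin (Arg z)"
    by (metis Im_rcis rcis_cmod_Arg)
  ultimately show ?thesis by (simp add: abs_mult mult.commute mult_left_mono)
qed simp

section \<open>Berezin estimates at normalised kernels\<close>

context rkhs
begin

lemma norm_rk_hat: "\<xi> \<in> \<X> \<Longrightarrow> norm (rk_hat ev \<xi>) = 1"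
  using rk_nonzero by (simp add: rk_hat_def)

text \<open>Supplies the boundedness on which the real suprema in \<open>ber\<close> and
  \<open>ber_norm\<close> rely.\<close>

lemma cmod_cinner_rk_hat_bound:
  assumes "bounded_linear A"
  obtains K where "\<And>\<xi> \<mu>. \<xi> \<in> \<X> \<Longrightarrow> \<mu> \<in> \<X> \<Longrightarrow> cmod (cinner (A (rk_hat ev \<xi>)) (rk_hat ev \<mu>)) \<le> K"
proof -
  obtain K where K: "\<And>x. norm (A x) \<le> norm x * K"
    using bounded_linear.bounded[OF assms] by blast
  have "cmod (cinner (A (rk_hat ev \<xi>)) (rk_hat ev \<mu>)) \<le> K" if "\<xi> \<in> \<X>" "\<mu> \<in> \<X>" for \<xi> \<mu>
    using cinner_Cauchy_Schwarz[of "A (rk_hat ev \<xi>)" "rk_hat ev \<mu>"] K[of "rk_hat ev \<xi>"] that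
    by (simp add: norm_rk_hat)
  thus ?thesis using that by blast
qed

lemma berezin_transform_le_ber:
  assumes "bounded_linear A" "\<xi> \<in> \<X>"
  shows "cmod (berezin_transform ev A \<xi>) \<le> ber \<X> ev A"
proof -
  obtain K where "\<And>\<xi> \<mu>. \<xi> \<in> \<X> \<Longrightarrow> \<mu> \<in> \<X> \<Longrightarrow> cmod (cinner (A (rk_hat ev \<xi>)) (rk_hat ev \<mu>)) \<le> K"
    using cmod_cinner_rk_hat_bound[OF assms(1)] by blast
  thus ?thesis unfolding ber_def
    using assms(2) by (intro cSUP_upper bdd_aboveI2[where M=K]) (auto simp: berezin_transform_def)
qed

lemma ber_le:
  "(\<And>\<xi>. \<xi> \<in> \<X> \<Longrightarrow> cmod (berezin_transform ev A \<xi>) \<le> c) \<Longrightarrow> ber \<X> ev A \<le> c"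
  unfolding ber_def using nonempty by (intro cSUP_least)

lemma ber_nonneg:
  assumes "bounded_linear A"
  shows "0 \<le> ber \<X> ev A"
proof -
  obtain \<xi> where "\<xi> \<in> \<X>" using nonempty by blast
  thus ?thesis using berezin_transform_le_ber[OF assms] norm_ge_zero order_trans by blast
qed

lemma berezin_transform_le_ber_norm:
  assumes "bounded_linear A" "\<xi> \<in> \<X>"
  shows "cmod (berezin_transform ev A \<xi>) \<le> ber_norm \<X> ev A"
proof -
  obtain K where K: "\<And>\<xi> \<mu>. \<xi> \<in> \<X> \<Longrightarrow> \<mu> \<in> \<X> \<Longrightarrow> cmod (cinner (A (rk_hat ev \<xi>)) (rk_hat ev \<mu>)) \<le> K"
    using cmod_cinner_rk_hat_bound[OF assms(1)] by blast
  \<comment> \<open>A diagonal pair, written as in \<open>ber_norm_def\<close> so that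
    \<open>cSUP_upper\<close> applies.\<close>
  have "(case (\<xi>, \<xi>) of (\<xi>, \<mu>) \<Rightarrow> cmod (cinner (A (rk_hat ev \<xi>)) (rk_hat ev \<mu>))) \<le> ber_norm \<X> ev A"
    unfolding ber_norm_def
    by (rule cSUP_upper) (use K assms(2) in \<open>auto intro!: bdd_aboveI2[where M=K]\<close>)
  thus ?thesis by (simp add: berezin_transform_def)
qed

text \<open>For selfadjoint \<open>A\<close> the squared norm is the Berezin transform of
  \<open>A ^^ 2\<close>.\<close>

lemma norm_square_le_ber_square:
  assumes A: "bounded_linear A" and sa: "\<And>x y. cinner (A x) y = cinner x (A y)" and "\<xi> \<in> \<X>"
  shows "(norm (A (rk_hat ev \<xi>)))\<^sup>2 \<le> ber \<X> ev (A ^^ 2)"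
proof -
  have "bounded_linear (A ^^ 2)"
    using bounded_linear_compose[OF A A] by (simp add: numeral_2_eq_2 o_def)
  from berezin_transform_le_ber[OF this \<open>\<xi> \<in> \<X>\<close>] show ?thesis
    by (simp add: berezin_transform_def sa[of "A _"] cinner_self norm_power numeral_2_eq_2 norm_mult)
qed

text \<open>The power inequalities of the class \<open>sectorial_Ber_P\<close> enter here, with
  exponent 2.\<close>

lemma norm_square_sum_le_ber:
  assumes "A \<in> sectorial_Ber_P \<X> ev \<theta>" and "\<xi> \<in> \<X>"
  shows "(norm (A (rk_hat ev \<xi>)))\<^sup>2 + (norm (cadjoint A (rk_hat ev \<xi>)))\<^sup>2
    \<le> 2 * ((ber \<X> ev (op_Re A))\<^sup>2 + (ber \<X> ev (op_Im A))\<^sup>2)"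
proof -
  have A: "bounded_clinear A"
    and P: "ber \<X> ev (op_Re A ^^ 2) \<le> (ber \<X> ev (op_Re A))\<^sup>2"
      "ber \<X> ev (op_Im A ^^ 2) \<le> (ber \<X> ev (op_Im A))\<^sup>2"
    using assms(1) by (auto simp: sectorial_Ber_P_def sectorial_Ber_def)
  have "(norm (op_Re A (rk_hat ev \<xi>)))\<^sup>2 \<le> ber \<X> ev (op_Re A ^^ 2)"
    by (rule norm_square_le_ber_square) (simp_all add: A assms(2) op_Re_selfadjoint
        bounded_clinear_op_Re bounded_clinear_bounded_linear)
  moreover have "(norm (op_Im A (rk_hat ev \<xi>)))\<^sup>2 \<le> ber \<X> ev (op_Im A ^^ 2)"
    by (rule norm_square_le_ber_square) (simp_all add: A assms(2) op_Im_selfadjoint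
        bounded_clinear_op_Im bounded_clinear_bounded_linear)
  ultimately show ?thesis using P by (simp add: norm_op_Re_Im_square)
qed

text \<open>The transform of \<open>op_Im A\<close> is the imaginary part of that of
  \<open>A\<close>, so the sector estimate applies pointwise.\<close>

lemma ber_op_Im_le:
  assumes A: "A \<in> sectorial_Ber \<X> ev \<theta>" and \<theta>: "0 < \<theta>" "\<theta> < pi / 2"
  shows "ber \<X> ev (op_Im A) \<le> sin \<theta> * ber \<X> ev A"
proof (rule ber_le)
  fix \<xi> assume \<xi>: "\<xi> \<in> \<X>"
  have cl: "bounded_clinear A" and sec: "berezin_transform ev A \<xi> \<in> sector \<theta>"
    using A \<xi> by (auto simp: sectorial_Ber_def Ber_def)
  have "cmod (berezin_transform ev (op_Im A) \<xi>) = \<bar>Im (berezin_transform ev A \<xi>)\<bar>"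
    by (simp add: berezin_transform_def cinner_op_Im[OF cl])
  also have "\<dots> \<le> sin \<theta> * cmod (berezin_transform ev A \<xi>)" by (rule sector_Im_le[OF sec \<theta>])
  also have "\<dots> \<le> sin \<theta> * ber \<X> ev A"
    using \<theta> berezin_transform_le_ber[OF bounded_clinear_bounded_linear[OF cl] \<xi>]
    by (intro mult_left_mono sin_ge_zero) auto
  finally show "cmod (berezin_transform ev (op_Im A) \<xi>) \<le> sin \<theta> * ber \<X> ev A" .
qed

end

section \<open>Cauchy-Schwarz in the plane and the final estimate\<close>

lemma sum_products_le_sqrt:
  "a * b + c * d \<le> sqrt (a\<^sup>2 + c\<^sup>2) * sqrt (b\<^sup>2 + d\<^sup>2)" for a b c d :: real
proof -
  \<comment> \<open>Lagrange's identity: this square is the gap between the two sides below.\<close>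
  have "0 \<le> (a * d - b * c)\<^sup>2" by simp
  hence "(a * b + c * d)\<^sup>2 \<le> (a\<^sup>2 + c\<^sup>2) * (b\<^sup>2 + d\<^sup>2)"
    by (simp add: power2_eq_square algebra_simps)
  thus ?thesis by (metis real_le_rsqrt real_sqrt_mult)
qed

theorem theorem4p4:
  fixes \<X> :: "'x set"
    and ev :: "'h::complex_hilbert \<Rightarrow> 'x \<Rightarrow> complex"
    and S T X Y :: "'h \<Rightarrow> 'h"
    and \<theta> :: real
  assumes "rkhs \<X> ev"
    and "0 < \<theta>" and "\<theta> < pi / 2"
    and "bounded_clinear S" and "bounded_clinear T" and "bounded_clinear X" and "bounded_clinear Y"
    and "S \<in> sectorial_Ber_P \<X> ev \<theta>"
  shows "ber \<X> ev (\<lambda>f. (S \<circ> X \<circ> T) f + (T \<circ> Y \<circ> S) f)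
           \<le> 2 * sin \<theta>
              * sqrt (ber_norm \<X> ev (\<lambda>f. (cadjoint T \<circ> (op_abs X ^^ 2) \<circ> T) f
                                        + (T \<circ> (op_abs (cadjoint Y) ^^ 2) \<circ> cadjoint T) f))
              * sqrt ((ber \<X> ev S)\<^sup>2
                       - (1 / sin \<theta>)\<^sup>2 / 2 * ((ber \<X> ev (op_Im S))\<^sup>2 - (ber \<X> ev (op_Re S))\<^sup>2))
       \<and> ber \<X> ev (\<lambda>f. (S \<circ> X \<circ> T) f - (T \<circ> Y \<circ> S) f)
           \<le> 2 * sin \<theta>
              * sqrt (ber_norm \<X> ev (\<lambda>f. (cadjoint T \<circ> (op_abs X ^^ 2) \<circ> T) f
                                        + (T \<circ> (op_abs (cadjoint Y) ^^ 2) \<circ> cadjoint T) f))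
              * sqrt ((ber \<X> ev S)\<^sup>2
                       - (1 / sin \<theta>)\<^sup>2 / 2 * ((ber \<X> ev (op_Im S))\<^sup>2 - (ber \<X> ev (op_Re S))\<^sup>2))"
proof -
  interpret rkhs \<X> ev by (rule assms(1))
  note cl = assms(4-7)
  define G where "G = (\<lambda>f. (cadjoint T \<circ> (op_abs X ^^ 2) \<circ> T) f
    + (T \<circ> (op_abs (cadjoint Y) ^^ 2) \<circ> cadjoint T) f)"
  define E where "E = (ber \<X> ev S)\<^sup>2
    - (1 / sin \<theta>)\<^sup>2 / 2 * ((ber \<X> ev (op_Im S))\<^sup>2 - (ber \<X> ev (op_Re S))\<^sup>2)"
  have G: "G x = cadjoint T (cadjoint X (X (T x))) + T (Y (cadjoint Y (cadjoint T x)))" for x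
    using cl by (simp add: G_def op_abs_square bounded_clinear_cadjoint cadjoint_cadjoint)
  have "bounded_clinear G"
    unfolding G_def using cl
    by (intro bounded_clinear_add bounded_clinear_comp)
      (simp_all add: op_abs_square bounded_clinear_cadjoint bounded_clinear_comp cadjoint_cadjoint)
  hence lG: "bounded_linear G" by (rule bounded_clinear_bounded_linear)
  have sin: "0 < sin \<theta>" using assms(2,3) by (intro sin_gt_zero) auto
  have SS: "S \<in> sectorial_Ber \<X> ev \<theta>" using assms(8) by (simp add: sectorial_Ber_P_def)
  have "(ber \<X> ev (op_Im S))\<^sup>2 \<le> (sin \<theta> * ber \<X> ev S)\<^sup>2"
    using ber_op_Im_le[OF SS assms(2,3)] cl(1)
    by (intro power_mono ber_nonneg bounded_clinear_bounded_linear bounded_clinear_op_Im)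
  \<comment> \<open>The factor cancels the cosecant. Writing i and r for the Berezin numbers of the
    imaginary and real parts, 2 (r^2 + i^2) = 4 i^2 - 2 (i^2 - r^2), so only the term 4 i^2 has to
    be estimated.\<close>
  moreover have "4 * (sin \<theta>)\<^sup>2 * E = 4 * (sin \<theta> * ber \<X> ev S)\<^sup>2
      - 2 * ((ber \<X> ev (op_Im S))\<^sup>2 - (ber \<X> ev (op_Re S))\<^sup>2)"
    using sin by (simp add: E_def field_simps power2_eq_square)
  ultimately have E: "2 * ((ber \<X> ev (op_Re S))\<^sup>2 + (ber \<X> ev (op_Im S))\<^sup>2) \<le> 4 * (sin \<theta>)\<^sup>2 * E"
    by simp
  have main: "norm (X (T (rk_hat ev \<xi>))) * norm (cadjoint S (rk_hat ev \<xi>))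
      + norm (cadjoint Y (cadjoint T (rk_hat ev \<xi>))) * norm (S (rk_hat ev \<xi>))
      \<le> 2 * sin \<theta> * sqrt (ber_norm \<X> ev G) * sqrt E" (is "?p * ?a + ?q * ?b \<le> _")
    if \<xi>: "\<xi> \<in> \<X>" for \<xi>
  proof -
    have "berezin_transform ev G \<xi> = of_real (?p\<^sup>2 + ?q\<^sup>2)"
      using cl by (simp add: berezin_transform_def G cinner_simps cinner_cadjoint cinner_cadjoint' cinner_self)
    hence "?p\<^sup>2 + ?q\<^sup>2 \<le> ber_norm \<X> ev G"
      using berezin_transform_le_ber_norm[OF lG \<xi>] by (simp only: norm_of_real)
    moreover have "?a\<^sup>2 + ?b\<^sup>2 \<le> 4 * (sin \<theta>)\<^sup>2 * E"
      using norm_square_sum_le_ber[OF assms(8) \<xi>] E by linarith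
    \<comment> \<open>\<open>mult_mono\<close> asks for a nonnegative
      \<open>ber_norm \<X> ev G\<close>; it dominates a sum of squares.\<close>
    ultimately have "sqrt (?p\<^sup>2 + ?q\<^sup>2) * sqrt (?a\<^sup>2 + ?b\<^sup>2)
        \<le> sqrt (ber_norm \<X> ev G) * sqrt (4 * (sin \<theta>)\<^sup>2 * E)"
      by (intro mult_mono real_sqrt_le_mono) (auto intro: order_trans[rotated])
    also have "sqrt (4 * (sin \<theta>)\<^sup>2 * E) = 2 * sin \<theta> * sqrt E"
      using sin by (simp add: real_sqrt_mult)
    finally show ?thesis using sum_products_le_sqrt[of ?p ?a ?q ?b] by (simp add: mult_ac)
  qed
  \<comment> \<open>Adjoints are moved so that each resulting norm occurs in
    \<open>main\<close>.\<close>
  have split: "cinner (S (X (T x))) x = cinner (X (T x)) (cadjoint S x)"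
    "cinner (T (Y (S x))) x = cinner (S x) (cadjoint Y (cadjoint T x))" for x
    using cl by (simp_all add: cinner_cadjoint)
  \<comment> \<open>Bounding the sum of the moduli serves both signs at once.\<close>
  have split_le: "cmod (cinner (S (X (T x))) x) + cmod (cinner (T (Y (S x))) x)
      \<le> norm (X (T x)) * norm (cadjoint S x) + norm (cadjoint Y (cadjoint T x)) * norm (S x)" for x
    unfolding split
    by (intro add_mono cinner_Cauchy_Schwarz) (metis cinner_Cauchy_Schwarz mult.commute)
  show ?thesis
    unfolding G_def[symmetric] E_def[symmetric]
  proof (intro conjI ber_le)
    fix \<xi> assume \<xi>: "\<xi> \<in> \<X>"
    show "cmod (berezin_transform ev (\<lambda>f. (S \<circ> X \<circ> T) f + (T \<circ> Y \<circ> S) f) \<xi>)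
        \<le> 2 * sin \<theta> * sqrt (ber_norm \<X> ev G) * sqrt E"
      unfolding berezin_transform_def o_apply cinner_add_left
      by (rule order_trans[OF norm_triangle_ineq order_trans[OF split_le main[OF \<xi>]]])
    show "cmod (berezin_transform ev (\<lambda>f. (S \<circ> X \<circ> T) f - (T \<circ> Y \<circ> S) f) \<xi>)
        \<le> 2 * sin \<theta> * sqrt (ber_norm \<X> ev G) * sqrt E"
      unfolding berezin_transform_def o_apply cinner_diff_left
      by (rule order_trans[OF norm_triangle_ineq4 order_trans[OF split_le main[OF \<xi>]]])
  qed
qed

end
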